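(* Let $n\ge1$ be an integer, $p\in[1,\infty)$, $l\in\mathbb{N}$ and $\sigma_0\in(0,1)$. Then, for any $v\in W^{l+\sigma_0,p}(\mathbb{R}^n)$, $$\lim_{\sigma\to0^{+}}\sigma\,|v|_{l+\sigma,p,\mathbb{R}^n}^p=\frac{4\pi^{n/2}}{p\,\Gamma(n/2)}\,|v|_{l,p,\mathbb{R}^n}^p,$$ where $\Gamma$ is the Euler Gamma function.
   Context: $\mathbb{N}$ contains $0$. $|\cdot|$ is the Euclidean norm on $\mathbb{R}^n$. For a multi-index $\alpha\in\mathbb{N}^n$, $|\alpha|=\alpha_1+\cdots+\alpha_n$ and $\partial^\alpha$ is the corresponding distributional derivative. For $r\in\mathbb{N}$, $W^{r,p}(\mathbb{R}^n)$ is the usual Sobolev space of $v\in L^p(\mathbb{R}^n)$ with $\partial^\alpha v\in L^p(\mathbb{R}^n)$ for all $|\alpha|\le r$, and for $l\in\{0,\dots,r\}$ $$|v|_{l,p,\mathbb{R}^n}=\Bigl(\sum_{|\alpha|=l}\int_{\mathbb{R}^n}|\partial^\alpha v(x)|^p\,dx\Bigr)^{1/p}.$$ For $l\in\mathbb{N}$ and $\sigma\in(0,1)$, the intrinsic (Gagliardo) semi-norm of order $l+\sigma$ is defined by $$|v|_{l+\sigma,p,\mathbb{R}^n}^p=\sum_{|\alpha|=l}\int_{\mathbb{R}^n\times\mathbb{R}^n}\frac{|\partial^\alpha v(x)-\partial^\alpha v(y)|^p}{|x-y|^{n+p\sigma}}\,dx\,dy,$$ and $W^{l+\sigma,p}(\mathbb{R}^n)$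 is the space of (equivalence classes of) functions $v\in W^{l,p}(\mathbb{R}^n)$ with $|v|_{l+\sigma,p,\mathbb{R}^n}<\infty$. *)

theory Defs
  imports "HOL-Analysis.Analysis"
begin

definition partial :: "'n \<Rightarrow> (real ^ 'n::finite \<Rightarrow> real) \<Rightarrow> real ^ 'n \<Rightarrow> real" where
  "partial i f x = frechet_derivative f (at x) (axis i 1)"

definition partials :: "'n list \<Rightarrow> (real ^ 'n::finite \<Rightarrow> real) \<Rightarrow> real ^ 'n \<Rightarrow> real" where
  "partials is f = foldr partial is f"

text \<open>
  Differentiability of all iterated partial derivatives entails their continuity,
  so this is the usual notion of a \<open>C\<^sup>\<infinity>\<close> function.
\<close>

definition smooth :: "(real ^ 'n::finite \<Rightarrow> real) \<Rightarrow> bool" where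
  "smooth f \<longleftrightarrow> (\<forall>is. partials is f differentiable_on UNIV)"

definition test_fun :: "(real ^ 'n::finite \<Rightarrow> real) \<Rightarrow> bool" where
  "test_fun \<phi> \<longleftrightarrow> smooth \<phi> \<and> compact (closure {x. \<phi> x \<noteq> 0})"

definition mi_order :: "nat ^ 'n::finite \<Rightarrow> nat" where
  "mi_order \<alpha> = (\<Sum>i\<in>UNIV. \<alpha> $ i)"

lemma finite_mi_order: "finite {\<alpha> :: nat ^ 'n::finite. mi_order \<alpha> = l}"
proof (rule finite_subset)
  show "{\<alpha> :: nat ^ 'n. mi_order \<alpha> = l} \<subseteq> vec_lambda ` (PiE UNIV (\<lambda>_. {..l}))"
  proof
    fix \<alpha> :: "nat ^ 'n" assume "\<alpha> \<in> {\<alpha>. mi_order \<alpha> = l}"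
    then have "\<alpha> $ i \<le> l" for i
      unfolding mi_order_def by (auto intro: member_le_sum)
    then have "vec_nth \<alpha> \<in> PiE UNIV (\<lambda>_. {..l})" by auto
    then show "\<alpha> \<in> vec_lambda ` (PiE UNIV (\<lambda>_. {..l}))"
      by (metis image_eqI vec_nth_inverse)
  qed
  show "finite (vec_lambda ` (PiE (UNIV :: 'n set) (\<lambda>_. {..l})))"
    by (intro finite_imageI finite_PiE) auto
qed

text \<open>
  The classical derivative of multi-index \<open>\<alpha>\<close>: differentiate \<open>\<alpha> $ i\<close> times in direction \<open>i\<close>.
  The index type carries no order, so some sequence of directions is picked; for a smooth
  function the result does not depend on it, by the symmetry of mixed partial derivatives.
\<close>

definition mi_deriv :: "nat ^ 'n::finite \<Rightarrow> (real ^ 'n \<Rightarrow> real) \<Rightarrow> real ^ 'n \<Rightarrow> real" where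
  "mi_deriv \<alpha> = partials (SOME is. \<forall>i. count_list is i = \<alpha> $ i)"

lemma ex_count_list: "\<exists>is. \<forall>i. count_list is i = (\<alpha> :: nat ^ 'n::finite) $ i"
proof -
  obtain "is" where "mset is = Abs_multiset (vec_nth \<alpha>)" by (metis ex_mset)
  then have "count (mset is) i = \<alpha> $ i" for i by (simp add: Abs_multiset_inverse)
  then show ?thesis by (metis count_mset)
qed

definition loc_integrable :: "(real ^ 'n::finite \<Rightarrow> real) \<Rightarrow> bool" where
  "loc_integrable f \<longleftrightarrow> (\<forall>K. compact K \<longrightarrow> set_integrable lebesgue K f)"

definition has_weak_deriv ::
    "nat ^ 'n::finite \<Rightarrow> (real ^ 'n \<Rightarrow> real) \<Rightarrow> (real ^ 'n \<Rightarrow> real) \<Rightarrow> bool" where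
  "has_weak_deriv \<alpha> v w \<longleftrightarrow> loc_integrable v \<and> loc_integrable w \<and>
     (\<forall>\<phi>. test_fun \<phi> \<longrightarrow>
        (LINT x|lebesgue. v x * mi_deriv \<alpha> \<phi> x)
          = (- 1) ^ mi_order \<alpha> * (LINT x|lebesgue. w x * \<phi> x))"

text \<open>
  A representative of the distributional derivative. It is determined up to a null set, and
  arbitrary if \<open>v\<close> has no locally integrable derivative of multi-index \<open>\<alpha>\<close>.
\<close>

definition weak_deriv :: "nat ^ 'n::finite \<Rightarrow> (real ^ 'n \<Rightarrow> real) \<Rightarrow> real ^ 'n \<Rightarrow> real" where
  "weak_deriv \<alpha> v = (SOME w. has_weak_deriv \<alpha> v w)"

text \<open>
  The spaces below consist of functions rather than of equivalence classes of functions.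
\<close>

definition Lp :: "real \<Rightarrow> (real ^ 'n::finite \<Rightarrow> real) set" where
  "Lp p = {f \<in> borel_measurable lebesgue. integrable lebesgue (\<lambda>x. \<bar>f x\<bar> powr p)}"

definition sobolev :: "nat \<Rightarrow> real \<Rightarrow> (real ^ 'n::finite \<Rightarrow> real) set" where
  "sobolev r p = {v \<in> Lp p. \<forall>\<alpha>. mi_order \<alpha> \<le> r \<longrightarrow>
     (\<exists>w. has_weak_deriv \<alpha> v w) \<and> weak_deriv \<alpha> v \<in> Lp p}"

definition sobolev_seminorm :: "nat \<Rightarrow> real \<Rightarrow> (real ^ 'n::finite \<Rightarrow> real) \<Rightarrow> real" where
  "sobolev_seminorm l p v =
     (\<Sum>\<alpha> | mi_order \<alpha> = l. LINT x|lebesgue. \<bar>weak_deriv \<alpha> v x\<bar> powr p) powr (1 / p)"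

text \<open>
  The \<open>p\<close>-th power of the Gagliardo semi-norm of order \<open>l + \<sigma>\<close>, possibly infinite.
  The integrand is \<open>0\<close> on the diagonal, which is a null set.
\<close>

definition gagliardo_pow ::
    "nat \<Rightarrow> real \<Rightarrow> real \<Rightarrow> (real ^ 'n::finite \<Rightarrow> real) \<Rightarrow> ennreal" where
  "gagliardo_pow l \<sigma> p v =
     (\<Sum>\<alpha> | mi_order \<alpha> = l.
        \<integral>\<^sup>+ z. ennreal (\<bar>weak_deriv \<alpha> v (fst z) - weak_deriv \<alpha> v (snd z)\<bar> powr p
                  / norm (fst z - snd z) powr (real CARD('n) + p * \<sigma>))
          \<partial>(lebesgue :: ((real ^ 'n) \<times> (real ^ 'n)) measure))"

definition frac_sobolev :: "nat \<Rightarrow> real \<Rightarrow> real \<Rightarrow> (real ^ 'n::finite \<Rightarrow> real) set" where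
  "frac_sobolev l \<sigma> p = {v \<in> sobolev l p. gagliardo_pow l \<sigma> p v < \<infinity>}"

end

theory Submission
  imports Defs
begin

text \<open>
  Write \<open>f\<close> for one of the derivatives \<open>\<partial>\<^sup>\<alpha> v\<close> of order \<open>l\<close>; both sides are sums over \<open>\<alpha>\<close>,
  so it suffices to treat a single \<open>f \<in> L\<^sup>p\<close> whose Gagliardo integral is finite at \<open>\<sigma>\<^sub>0\<close>.
  Substituting \<open>y = x + h\<close> turns that integral into
  \<open>\<integral> K(h) |h|\<^bsup>-n - p \<sigma>\<^esup> dh\<close> with \<open>K(h) = \<integral> |f(x) - f(x + h)|\<^sup>p dx\<close>
  (\<open>nn_integral_gagliardo_shift\<close>), and two facts decide the limit.

  First, for large \<open>|h|\<close> the functions \<open>f\<close> and \<open>f(\<cdot> + h)\<close> are almost disjointly supported, so that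
  \<open>K(h)\<close> tends to \<open>2 \<parallel>f\<parallel>\<^sup>p\<close> as \<open>|h|\<close> tends to infinity
  (\<open>tendsto_shift_difference_powr_at_infinity\<close>).  Second, as \<open>\<sigma>\<close> decreases to \<open>0\<close> the measures
  \<open>\<sigma> |h|\<^bsup>-n - p \<sigma>\<^esup> dh\<close> send their mass to infinity: the part outside a ball of radius \<open>R\<close>
  has the mass \<open>n \<omega>\<^sub>n R\<^bsup>-p \<sigma>\<^esup> / p\<close>, where \<open>\<omega>\<^sub>n\<close> is the volume of the unit ball, and this tends to
  \<open>n \<omega>\<^sub>n / p\<close> whatever \<open>R\<close> is.  The part inside the ball is controlled by the integral at
  \<open>\<sigma>\<^sub>0\<close> and disappears because of the factor \<open>\<sigma>\<close>.  The limit is therefore the value of \<open>K\<close> at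
  infinity times \<open>n \<omega>\<^sub>n / p\<close> (\<open>tendsto_scaled_singular_integral\<close>), and
  \<open>n \<omega>\<^sub>n = 2 \<pi>\<^bsup>n/2\<^esup> / \<Gamma>(n/2)\<close> yields the constant.
\<close>

section \<open>The mass of a radial power outside a ball\<close>

lemma nn_integral_powr_tail:
  fixes s r :: real
  assumes "0 < s" and "0 < r"
  shows "(\<integral>\<^sup>+ t. ennreal (s * t powr (- s - 1)) * indicator {r..} t \<partial>lborel) = ennreal (r powr (- s))"
proof -
  have "((\<lambda>t. - (t powr (- s))) \<longlongrightarrow> - 0) at_top"
    using assms by (intro tendsto_minus tendsto_neg_powr filterlim_ident) auto
  then have "(\<integral>\<^sup>+ t. ennreal (s * t powr (- s - 1)) * indicator {r..} t \<partial>lborel) = 0 - - (r powr (- s))"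
    using assms
    by (intro nn_integral_FTC_atLeast[where F = "\<lambda>t. - (t powr (- s))"])
       (auto intro!: derivative_eq_intros)
  then show ?thesis by simp
qed

lemma emeasure_annulus:
  assumes "0 \<le> R" and "R \<le> t"
  shows "emeasure lborel {h :: 'a::euclidean_space. R \<le> norm h \<and> norm h \<le> t}
    = ennreal (unit_ball_vol DIM('a) * (t ^ DIM('a) - R ^ DIM('a)))"
proof -
  have "{h :: 'a. R \<le> norm h \<and> norm h \<le> t} = cball 0 t - ball 0 R"
    by auto
  also have "emeasure lborel \<dots> = emeasure lborel (cball (0::'a) t) - emeasure lborel (ball (0::'a) R)"
    using assms by (intro emeasure_Diff) (auto simp: emeasure_ball)
  also have "\<dots> = ennreal (unit_ball_vol DIM('a) * (t ^ DIM('a) - R ^ DIM('a)))"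
    using assms by (simp add: emeasure_ball emeasure_cball ennreal_minus right_diff_distrib)
  finally show ?thesis .
qed

text \<open>
  Polar coordinates are replaced by a layer-cake argument: \<open>|h|\<^bsup>-s\<^esup>\<close> is the integral of
  \<open>s t\<^bsup>-s-1\<^esup>\<close> over \<open>t \<ge> |h|\<close>, and exchanging the integrals leaves the volume of the annulus
  \<open>R \<le> |h| \<le> t\<close>, which is explicit.
\<close>

lemma nn_integral_norm_powr_outside_ball:
  fixes s R :: real
  assumes "0 < R" and s: "real DIM('a::euclidean_space) < s"
  shows "(\<integral>\<^sup>+ h. ennreal (norm h powr (- s)) * indicator {h. R \<le> norm h} h \<partial>(lborel :: 'a measure))
    = ennreal (real DIM('a) * unit_ball_vol DIM('a) * R powr (real DIM('a) - s) / (s - real DIM('a)))"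
    (is "?L = _")
proof -
  define n where "n = DIM('a)"
  define \<omega> where "\<omega> = unit_ball_vol (real n)"
  have \<omega>: "0 \<le> \<omega>" unfolding \<omega>_def by simp
  have s0: "0 < s" and sn: "real n < s" using s by (auto simp: n_def)
  have "?L = (\<integral>\<^sup>+ h. \<integral>\<^sup>+ t. ennreal (s * t powr (- s - 1)) *
      indicator {h. R \<le> norm h \<and> norm h \<le> t} h \<partial>lborel \<partial>(lborel :: 'a measure))"
  proof (intro nn_integral_cong)
    fix h :: 'a
    show "ennreal (norm h powr (- s)) * indicator {h. R \<le> norm h} h =
      (\<integral>\<^sup>+ t. ennreal (s * t powr (- s - 1)) * indicator {h. R \<le> norm h \<and> norm h \<le> t} h \<partial>lborel)"
    proof (cases "R \<le> norm h")
      case True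
      have "(\<integral>\<^sup>+ t. ennreal (s * t powr (- s - 1)) * indicator {h. R \<le> norm h \<and> norm h \<le> t} h \<partial>lborel)
        = (\<integral>\<^sup>+ t. ennreal (s * t powr (- s - 1)) * indicator {norm h..} t \<partial>lborel)"
        using True by (intro nn_integral_cong) (auto simp: indicator_def)
      also have "\<dots> = ennreal (norm h powr (- s))"
        using True \<open>0 < R\<close> s0 by (intro nn_integral_powr_tail) auto
      finally show ?thesis using True by simp
    qed simp
  qed
  also have "\<dots> = (\<integral>\<^sup>+ t. \<integral>\<^sup>+ h. ennreal (s * t powr (- s - 1)) *
      indicator {h :: 'a. R \<le> norm h \<and> norm h \<le> t} h \<partial>lborel \<partial>lborel)"
    by (rule lborel_pair.Fubini') (simp add: case_prod_beta, measurable)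
  also have "\<dots> = (\<integral>\<^sup>+ t. ennreal (\<omega> * s * t powr (- s - 1) * (t ^ n - R ^ n)) * indicator {R..} t \<partial>lborel)"
  proof (intro nn_integral_cong)
    fix t :: real
    have "(\<integral>\<^sup>+ h. ennreal (s * t powr (- s - 1)) *
        indicator {h :: 'a. R \<le> norm h \<and> norm h \<le> t} h \<partial>lborel)
      = ennreal (s * t powr (- s - 1)) * emeasure lborel {h :: 'a. R \<le> norm h \<and> norm h \<le> t}"
      by (subst nn_integral_cmult_indicator) auto
    also have "\<dots> = ennreal (\<omega> * s * t powr (- s - 1) * (t ^ n - R ^ n)) * indicator {R..} t"
    proof (cases "R \<le> t")
      case True
      then have "R ^ n \<le> t ^ n" using \<open>0 < R\<close> by (intro power_mono) auto
      then show ?thesis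
        using True \<open>0 < R\<close> s0 \<omega>
        by (simp add: emeasure_annulus n_def[symmetric] \<omega>_def[symmetric] ennreal_mult[symmetric] mult_ac)
    next
      case False
      then have "{h :: 'a. R \<le> norm h \<and> norm h \<le> t} = {}" by auto
      then show ?thesis using False by (simp del: Collect_empty_eq)
    qed
    finally show "(\<integral>\<^sup>+ h. ennreal (s * t powr (- s - 1)) *
        indicator {h :: 'a. R \<le> norm h \<and> norm h \<le> t} h \<partial>lborel) = \<dots>" .
  qed
  also have "\<dots> = ennreal (0 - \<omega> * (s / (n - s) * R powr (n - s) + R ^ n * R powr (- s)))"
  proof (rule nn_integral_FTC_atLeast[where
        F = "\<lambda>t. \<omega> * (s / (n - s) * t powr (n - s) + R ^ n * t powr (- s))"])
    fix t assume t: "R \<le> t"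
    then have "0 < t" using \<open>0 < R\<close> by simp
    have "t ^ n * t powr (- s - 1) = t powr (n - s - 1)"
      using \<open>0 < t\<close> by (simp add: powr_realpow[symmetric] powr_add[symmetric] algebra_simps)
    then have "\<omega> * (s / (n - s) * ((n - s) * t powr (n - s - 1)) + R ^ n * (- s * t powr (- s - 1)))
      = \<omega> * s * t powr (- s - 1) * (t ^ n - R ^ n)"
      using sn by (simp add: right_diff_distrib mult_ac)
    then show "DERIV (\<lambda>t. \<omega> * (s / (n - s) * t powr (n - s) + R ^ n * t powr (- s))) t :>
        \<omega> * s * t powr (- s - 1) * (t ^ n - R ^ n)"
    proof (rule DERIV_cong[rotated])
      show "DERIV (\<lambda>t. \<omega> * (s / (n - s) * t powr (n - s) + R ^ n * t powr (- s))) t :>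
          \<omega> * (s / (n - s) * ((n - s) * t powr (n - s - 1)) + R ^ n * (- s * t powr (- s - 1)))"
        using \<open>0 < t\<close> by (intro DERIV_cmult DERIV_add has_real_derivative_powr)
    qed
    have "R ^ n \<le> t ^ n" using t \<open>0 < R\<close> by (intro power_mono) auto
    then show "0 \<le> \<omega> * s * t powr (- s - 1) * (t ^ n - R ^ n)" using \<omega> s0 by auto
  next
    have "((\<lambda>t. \<omega> * (s / (n - s) * t powr (n - s) + R ^ n * t powr (- s)))
      \<longlongrightarrow> \<omega> * (s / (n - s) * 0 + R ^ n * 0)) at_top"
      using sn s0 by (intro tendsto_intros tendsto_neg_powr filterlim_ident) auto
    then show "((\<lambda>t. \<omega> * (s / (n - s) * t powr (n - s) + R ^ n * t powr (- s))) \<longlongrightarrow> 0) at_top"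
      by simp
  qed measurable
  also have "0 - \<omega> * (s / (n - s) * R powr (n - s) + R ^ n * R powr (- s)) =
      n * \<omega> * R powr (n - s) / (s - n)"
  proof -
    have *: "R ^ n * R powr (- s) = R powr (n - s)"
      using \<open>0 < R\<close> by (simp add: powr_realpow[symmetric] powr_add[symmetric])
    show ?thesis unfolding * using sn by (simp add: field_simps)
  qed
  finally show ?thesis by (simp add: n_def \<omega>_def)
qed

lemma dim_times_unit_ball_vol:
  assumes "0 < n"
  shows "n * unit_ball_vol n = 2 * pi powr (n / 2) / Gamma (n / 2)"
proof -
  have "Gamma (n / 2 + 1) = n / 2 * Gamma (n / 2)"
    using assms by (intro Gamma_plus1) (auto elim!: nonpos_Ints_cases)
  then have "unit_ball_vol n = pi powr (n / 2) / (n / 2 * Gamma (n / 2))"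
    unfolding unit_ball_vol_def by metis
  then show ?thesis
    using assms by simp
qed


section \<open>Translates in \<open>L\<^sup>p\<close> decouple at infinity\<close>

lemma integrable_shift:
  fixes u :: "'a::euclidean_space \<Rightarrow> real"
  assumes "integrable lborel u"
  shows "integrable lborel (\<lambda>x. u (h + x))"
proof -
  have "integrable (distr lborel borel ((+) h)) u"
    unfolding lborel_distr_plus by (rule assms)
  then show ?thesis
    by (subst (asm) integrable_distr_eq) (use assms in auto)
qed

lemma integral_shift:
  fixes u :: "'a::euclidean_space \<Rightarrow> real"
  assumes "integrable lborel u"
  shows "(\<integral>x. u (h + x) \<partial>lborel) = (\<integral>x. u x \<partial>lborel)"
proof -
  have "(\<integral>x. u x \<partial>lborel) = (\<integral>x. u x \<partial>distr lborel borel ((+) h))"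
    unfolding lborel_distr_plus ..
  also have "\<dots> = (\<integral>x. u (h + x) \<partial>lborel)"
    by (subst integral_distr) (use assms in auto)
  finally show ?thesis ..
qed

lemma nn_integral_shift:
  fixes f :: "'a::euclidean_space \<Rightarrow> ennreal"
  assumes [measurable]: "f \<in> borel_measurable borel"
  shows "(\<integral>\<^sup>+ y. f y \<partial>lborel) = (\<integral>\<^sup>+ h. f (h + x) \<partial>lborel)"
proof -
  have "(\<integral>\<^sup>+ y. f y \<partial>lborel) = (\<integral>\<^sup>+ y. f y \<partial>distr lborel borel ((+) x))"
    unfolding lborel_distr_plus ..
  also have "\<dots> = (\<integral>\<^sup>+ h. f (h + x) \<partial>lborel)"
    by (subst nn_integral_distr) (auto simp: add.commute)
  finally show ?thesis .
qed

text \<open>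
  Up to a small relative error, the \<open>p\<close>-th power is additive as soon as one of the two numbers is
  much smaller than the other; the minimum pays for the case of comparable sizes.  This is a
  symmetric form of the elementary inequality behind the Brezis-Lieb lemma.  By symmetry and
  homogeneity it is enough to take \<open>a = 1\<close> and \<open>b = t\<close> with \<open>|t| \<le> 1\<close>.
\<close>

lemma abs_diff_powr_near_split:
  fixes p \<epsilon> :: real
  assumes p: "1 \<le> p" and \<epsilon>: "0 < \<epsilon>"
  shows "\<exists>C\<ge>0. \<forall>a b. \<bar>\<bar>a - b\<bar> powr p - \<bar>a\<bar> powr p - \<bar>b\<bar> powr p\<bar>
    \<le> \<epsilon> * (\<bar>a\<bar> powr p + \<bar>b\<bar> powr p) + C * min (\<bar>a\<bar> powr p) (\<bar>b\<bar> powr p)"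
proof -
  have "isCont (\<lambda>t. \<bar>1 - t\<bar> powr p) 0"
    by (intro continuous_intros) auto
  then have "((\<lambda>t. \<bar>1 - t\<bar> powr p) \<longlongrightarrow> 1) (at 0)"
    by (simp add: isCont_def)
  from LIM_D[OF this \<epsilon>] obtain \<delta> where \<delta>: "0 < \<delta>"
    and near: "\<And>t. t \<noteq> 0 \<Longrightarrow> \<bar>t\<bar> < \<delta> \<Longrightarrow> \<bar>\<bar>1 - t\<bar> powr p - 1\<bar> < \<epsilon>"
    by (auto simp: real_norm_def)
  \<comment> \<open>For \<open>\<delta> \<le> |t| \<le> 1\<close> the number \<open>|1 - t|\<^sup>p\<close> differs from \<open>1\<close> by at most
    \<open>2\<^sup>p + 1 \<le> (2\<^sup>p + 1) (|t| / \<delta>)\<^sup>p\<close>; the summand \<open>1\<close> absorbs the term \<open>|t|\<^sup>p\<close> itself.\<close>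
  define C where "C = 1 + (2 powr p + 1) / \<delta> powr p"
  have C: "0 \<le> C" unfolding C_def by simp
  have unit: "\<bar>\<bar>1 - t\<bar> powr p - 1 - \<bar>t\<bar> powr p\<bar> \<le> \<epsilon> + C * \<bar>t\<bar> powr p" if t: "\<bar>t\<bar> \<le> 1" for t
  proof -
    have "\<bar>\<bar>1 - t\<bar> powr p - 1\<bar> \<le> \<epsilon> + (2 powr p + 1) / \<delta> powr p * \<bar>t\<bar> powr p"
    proof (cases "\<bar>t\<bar> < \<delta>")
      case True
      then have "\<bar>\<bar>1 - t\<bar> powr p - 1\<bar> \<le> \<epsilon>"
        using near[of t] \<epsilon> by (cases "t = 0") auto
      moreover have "0 \<le> (2 powr p + 1) / \<delta> powr p * \<bar>t\<bar> powr p" by simp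
      ultimately show ?thesis by linarith
    next
      case False
      have "\<bar>1 - t\<bar> powr p \<le> 2 powr p" using t p by (intro powr_mono2) auto
      then have "\<bar>\<bar>1 - t\<bar> powr p - 1\<bar> \<le> 2 powr p + 1"
        using powr_ge_zero[of "\<bar>1 - t\<bar>" p] by linarith
      also have "\<dots> \<le> (2 powr p + 1) / \<delta> powr p * \<bar>t\<bar> powr p"
      proof -
        have "\<delta> powr p \<le> \<bar>t\<bar> powr p" using False \<delta> p by (intro powr_mono2) auto
        then have "(2 powr p + 1) * \<delta> powr p \<le> (2 powr p + 1) * \<bar>t\<bar> powr p"
          by (intro mult_left_mono) auto
        then show ?thesis using \<delta> by (simp add: field_simps)
      qed
      finally show ?thesis using \<epsilon> by linarith
    qed
    moreover have "C * \<bar>t\<bar> powr p = \<bar>t\<bar> powr p + (2 powr p + 1) / \<delta> powr p * \<bar>t\<bar> powr p"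
      unfolding C_def by (simp only: distrib_right mult_1)
    ultimately show ?thesis
      using powr_ge_zero[of "\<bar>t\<bar>" p] by linarith
  qed
  have half: "\<bar>\<bar>a - b\<bar> powr p - \<bar>a\<bar> powr p - \<bar>b\<bar> powr p\<bar> \<le>
      \<epsilon> * (\<bar>a\<bar> powr p + \<bar>b\<bar> powr p) + C * min (\<bar>a\<bar> powr p) (\<bar>b\<bar> powr p)"
    if ab: "\<bar>b\<bar> \<le> \<bar>a\<bar>" for a b
  proof (cases "a = 0")
    case True
    then show ?thesis using ab by simp
  next
    case False
    define t where "t = b / a"
    have b: "b = a * t" and t: "\<bar>t\<bar> \<le> 1" using False ab by (auto simp: t_def)
    have eqs: "\<bar>b\<bar> powr p = \<bar>a\<bar> powr p * \<bar>t\<bar> powr p" "\<bar>a - b\<bar> powr p = \<bar>a\<bar> powr p * \<bar>1 - t\<bar> powr p"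
    proof -
      have "a - b = a * (1 - t)" by (simp add: b algebra_simps)
      then show "\<bar>a - b\<bar> powr p = \<bar>a\<bar> powr p * \<bar>1 - t\<bar> powr p"
        by (simp add: abs_mult powr_mult)
    qed (simp add: b abs_mult powr_mult)
    have "\<bar>\<bar>a - b\<bar> powr p - \<bar>a\<bar> powr p - \<bar>b\<bar> powr p\<bar>
        = \<bar>a\<bar> powr p * \<bar>\<bar>1 - t\<bar> powr p - 1 - \<bar>t\<bar> powr p\<bar>"
    proof -
      have "\<bar>a - b\<bar> powr p - \<bar>a\<bar> powr p - \<bar>b\<bar> powr p
        = \<bar>a\<bar> powr p * (\<bar>1 - t\<bar> powr p - 1 - \<bar>t\<bar> powr p)"
        unfolding eqs by (simp add: algebra_simps)
      then show ?thesis by (simp add: abs_mult)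
    qed
    also have "\<dots> \<le> \<bar>a\<bar> powr p * (\<epsilon> + C * \<bar>t\<bar> powr p)"
      by (intro mult_left_mono unit t) auto
    also have "\<dots> = \<epsilon> * \<bar>a\<bar> powr p + C * \<bar>b\<bar> powr p"
      unfolding eqs by (simp add: algebra_simps)
    also have "\<dots> \<le> \<epsilon> * (\<bar>a\<bar> powr p + \<bar>b\<bar> powr p) + C * \<bar>b\<bar> powr p"
      using \<epsilon> by (intro add_right_mono mult_left_mono) auto
    finally show ?thesis
      using ab p powr_mono2[of p "\<bar>b\<bar>" "\<bar>a\<bar>"] by (simp add: min_absorb2)
  qed
  have "\<bar>\<bar>a - b\<bar> powr p - \<bar>a\<bar> powr p - \<bar>b\<bar> powr p\<bar> \<le>
      \<epsilon> * (\<bar>a\<bar> powr p + \<bar>b\<bar> powr p) + C * min (\<bar>a\<bar> powr p) (\<bar>b\<bar> powr p)" for a b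
  proof (cases "\<bar>b\<bar> \<le> \<bar>a\<bar>")
    case False
    then have "\<bar>a\<bar> \<le> \<bar>b\<bar>" by simp
    from half[OF this] show ?thesis by (simp add: abs_minus_commute algebra_simps min.commute)
  qed (rule half)
  then show ?thesis using C by blast
qed

text \<open>
  If \<open>|h| > 2 m\<close>, then \<open>x\<close> and \<open>x + h\<close> cannot both lie in the ball of radius \<open>m\<close>, so the minimum
  is dominated by the part of \<open>u\<close> outside that ball, counted twice.
\<close>

lemma eventually_min_shift_integral_less:
  fixes u :: "'a::euclidean_space \<Rightarrow> real"
  assumes u: "integrable lborel u" and nonneg: "\<And>x. 0 \<le> u x" and \<epsilon>: "0 < \<epsilon>"
  shows "\<forall>\<^sub>F h in at_infinity. (\<integral>x. min (u x) (u (h + x)) \<partial>lborel) < \<epsilon>"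
proof -
  let ?T = "\<lambda>m x. u x * indicator {x. real m < norm x} x"
  have [measurable]: "u \<in> borel_measurable borel" using u by auto
  have T: "integrable lborel (?T m)" for m
    by (intro integrable_real_mult_indicator u) auto
  have "(\<lambda>m. \<integral>x. ?T m x \<partial>lborel) \<longlonglongrightarrow> (\<integral>x. 0 \<partial>(lborel :: 'a measure))"
  proof (rule integral_dominated_convergence[where w = u])
    show "AE x in lborel. (\<lambda>m. ?T m x) \<longlonglongrightarrow> 0"
    proof (rule AE_I2)
      fix x :: 'a
      have "\<forall>\<^sub>F m in sequentially. ?T m x = 0"
        using eventually_ge_at_top[of "nat \<lceil>norm x\<rceil>"]
        by eventually_elim (auto simp: indicator_def nat_le_iff ceiling_le_iff)
      then show "(\<lambda>m. ?T m x) \<longlonglongrightarrow> 0" by (rule tendsto_eventually)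
    qed
  qed (use u nonneg in \<open>auto simp: indicator_def\<close>)
  then have "\<forall>\<^sub>F m in sequentially. (\<integral>x. ?T m x \<partial>lborel) < \<epsilon> / 2"
    using \<epsilon> by (intro order_tendstoD) auto
  then obtain m where m: "(\<integral>x. ?T m x \<partial>lborel) < \<epsilon> / 2"
    by (auto simp: eventually_sequentially)
  have "(\<integral>x. min (u x) (u (h + x)) \<partial>lborel) < \<epsilon>" if h: "2 * real m + 1 \<le> norm h" for h
  proof -
    have T': "integrable lborel (\<lambda>x. ?T m (h + x))"
      and int_T': "(\<integral>x. ?T m (h + x) \<partial>lborel) = (\<integral>x. ?T m x \<partial>lborel)"
      using integrable_shift[OF T] integral_shift[OF T] by auto
    have "(\<integral>x. min (u x) (u (h + x)) \<partial>lborel) \<le> (\<integral>x. ?T m x + ?T m (h + x) \<partial>lborel)"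
    proof (rule integral_mono')
      show "integrable lborel (\<lambda>x. ?T m x + ?T m (h + x))" using T T' by simp
      fix x :: 'a
      have "norm h \<le> norm (h + x) + norm x"
        using norm_triangle_ineq4[of "h + x" x] by simp
      then have "real m < norm x \<or> real m < norm (h + x)" using h by linarith
      then show "min (u x) (u (h + x)) \<le> ?T m x + ?T m (h + x)"
        using nonneg[of x] nonneg[of "h + x"] by (auto simp: indicator_def)
    qed (simp add: nonneg)
    also have "\<dots> = 2 * (\<integral>x. ?T m x \<partial>lborel)"
      using T T' int_T' by (simp add: Bochner_Integration.integral_add)
    also have "\<dots> < \<epsilon>" using m by simp
    finally show ?thesis .
  qed
  then show ?thesis unfolding eventually_at_infinity by blast
qed

text \<open>
  Integrating the inequality \<open>abs_diff_powr_near_split\<close> at \<open>a = f(x)\<close>, \<open>b = f(x + h)\<close> compares the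
  left-hand side with \<open>\<parallel>f\<parallel>\<^sup>p + \<parallel>f(\<cdot> + h)\<parallel>\<^sup>p = 2 \<parallel>f\<parallel>\<^sup>p\<close>; the integrated minimum vanishes at infinity.
\<close>

lemma tendsto_shift_difference_powr_at_infinity:
  fixes f :: "'a::euclidean_space \<Rightarrow> real" and p :: real
  assumes p: "1 \<le> p"
    and f [measurable]: "f \<in> borel_measurable borel"
    and int: "integrable lborel (\<lambda>x. \<bar>f x\<bar> powr p)"
  shows "((\<lambda>h. \<integral>\<^sup>+ x. ennreal (\<bar>f x - f (h + x)\<bar> powr p) \<partial>lborel)
    \<longlongrightarrow> ennreal (2 * (\<integral>x. \<bar>f x\<bar> powr p \<partial>lborel))) at_infinity"
proof -
  define u where "u x = \<bar>f x\<bar> powr p" for x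
  define N where "N = (\<integral>x. u x \<partial>lborel)"
  have [measurable]: "u \<in> borel_measurable borel" unfolding u_def by measurable
  have u: "integrable lborel u" and u0: "0 \<le> u x" for x
    using int unfolding u_def by auto
  have N: "0 \<le> N" unfolding N_def by (intro integral_nonneg_AE) (auto simp: u0)
  have uh: "integrable lborel (\<lambda>x. u (h + x))"
    and int_uh: "(\<integral>x. u (h + x) \<partial>lborel) = N" for h
    using integrable_shift[OF u] integral_shift[OF u] by (auto simp: N_def)
  define m where "m h x = min (u x) (u (h + x))" for h x
  have m: "integrable lborel (m h)" for h
    unfolding m_def by (intro integrable_min u uh)
  define d where "d h x = \<bar>f x - f (h + x)\<bar> powr p" for h x
  have [measurable]: "d h \<in> borel_measurable borel" for h unfolding d_def by measurable
  have split: "\<exists>C\<ge>0. \<forall>h x. \<bar>d h x - u x - u (h + x)\<bar> \<le> \<epsilon> * (u x + u (h + x)) + C * m h x"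
    if "0 < \<epsilon>" for \<epsilon>
    using abs_diff_powr_near_split[OF p that] unfolding d_def u_def m_def by meson
  obtain C1 where C1: "\<And>h x. \<bar>d h x - u x - u (h + x)\<bar> \<le> 1 * (u x + u (h + x)) + C1 * m h x"
    using split[of 1] by auto
  have diff: "integrable lborel (\<lambda>x. d h x - u x - u (h + x))" for h
  proof (rule Bochner_Integration.integrable_bound)
    show "integrable lborel (\<lambda>x. 1 * (u x + u (h + x)) + C1 * m h x)"
      by (intro Bochner_Integration.integrable_add integrable_mult_right u uh m)
    show "AE x in lborel. norm (d h x - u x - u (h + x)) \<le> norm (1 * (u x + u (h + x)) + C1 * m h x)"
      using C1 by (intro AE_I2) (metis abs_ge_self order_trans real_norm_def)
  qed measurable
  have d: "integrable lborel (d h)" for h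
    using Bochner_Integration.integrable_add[OF Bochner_Integration.integrable_add[OF diff[of h] uh[of h]] u]
    by simp
  have "((\<lambda>h. \<integral>x. d h x \<partial>lborel) \<longlongrightarrow> 2 * N) at_infinity"
  proof (rule tendstoI)
    fix e :: real assume e: "0 < e"
    \<comment> \<open>The choice makes the contribution \<open>2 \<epsilon> N\<close> smaller than \<open>e / 2\<close>, also if \<open>N = 0\<close>.\<close>
    define \<epsilon> where "\<epsilon> = e / (4 * (N + 1))"
    have \<epsilon>: "0 < \<epsilon>" using e N by (simp add: \<epsilon>_def)
    obtain C where C: "0 \<le> C"
      and bound: "\<And>h x. \<bar>d h x - u x - u (h + x)\<bar> \<le> \<epsilon> * (u x + u (h + x)) + C * m h x"
      using split[OF \<epsilon>] by auto
    have "\<forall>\<^sub>F h in at_infinity. (\<integral>x. m h x \<partial>lborel) < e / (2 * (C + 1))"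
      unfolding m_def using e C by (intro eventually_min_shift_integral_less u u0) auto
    then show "\<forall>\<^sub>F h in at_infinity. dist (\<integral>x. d h x \<partial>lborel) (2 * N) < e"
    proof eventually_elim
      case (elim h)
      have "(\<integral>x. d h x \<partial>lborel) - 2 * N = (\<integral>x. d h x - u x - u (h + x) \<partial>lborel)"
        using u uh[of h] d[of h] int_uh[of h] N_def by simp
      also have "\<bar>\<dots>\<bar> \<le> (\<integral>x. \<epsilon> * (u x + u (h + x)) + C * m h x \<partial>lborel)"
        by (intro integral_abs_bound[THEN order_trans] integral_mono integrable_abs diff bound
            Bochner_Integration.integrable_add integrable_mult_right u uh m)
      also have "\<dots> = \<epsilon> * (2 * N) + C * (\<integral>x. m h x \<partial>lborel)"
        using u uh[of h] m[of h] int_uh[of h] N_def by simp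
      also have "\<dots> < e"
      proof -
        have "\<epsilon> * (2 * N) < e / 2" using e N by (simp add: \<epsilon>_def field_simps)
        moreover have "C * (\<integral>x. m h x \<partial>lborel) \<le> C * (e / (2 * (C + 1)))"
          using elim C by (intro mult_left_mono) auto
        moreover have "C * (e / (2 * (C + 1))) \<le> e / 2" using e C by (simp add: field_simps)
        ultimately show ?thesis by linarith
      qed
      finally show ?case by (simp add: dist_real_def)
    qed
  qed
  then have "((\<lambda>h. ennreal (\<integral>x. d h x \<partial>lborel)) \<longlongrightarrow> ennreal (2 * N)) at_infinity"
    by (rule tendsto_ennrealI)
  moreover have "(\<integral>\<^sup>+ x. ennreal (d h x) \<partial>lborel) = ennreal (\<integral>x. d h x \<partial>lborel)" for h
    by (intro nn_integral_eq_integral d) (auto simp: d_def)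
  ultimately show ?thesis by (simp add: d_def N_def u_def)
qed

section \<open>Singular integrals whose mass escapes to infinity\<close>

text \<open>
  For every radius \<open>R\<close> the integral splits into a near part, bounded by a multiple of the
  integral at \<open>\<sigma>\<^sub>0\<close>, and a far part in which \<open>K\<close> may be replaced by constants \<open>a < \<kappa> < b\<close> once
  \<open>R\<close> is large.  Finiteness at \<open>\<sigma>\<^sub>0\<close> is what tames the singularity at the origin, uniformly for
  \<open>\<sigma> < \<sigma>\<^sub>0\<close>.
\<close>

lemma tendsto_scaled_singular_integral:
  fixes K :: "'a::euclidean_space \<Rightarrow> ennreal" and p \<sigma>\<^sub>0 \<kappa> :: real
  defines "w \<equiv> \<lambda>\<sigma> (h::'a). ennreal (norm h powr - (real DIM('a) + p * \<sigma>))"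
  assumes p: "0 < p" and \<sigma>\<^sub>0: "0 < \<sigma>\<^sub>0" and \<kappa>: "0 \<le> \<kappa>"
    and K [measurable]: "K \<in> borel_measurable borel"
    and lim: "(K \<longlongrightarrow> ennreal \<kappa>) at_infinity"
    and fin: "(\<integral>\<^sup>+ h. K h * w \<sigma>\<^sub>0 h \<partial>lborel) < \<infinity>"
  shows "((\<lambda>\<sigma>. ennreal \<sigma> * (\<integral>\<^sup>+ h. K h * w \<sigma> h \<partial>lborel))
    \<longlongrightarrow> ennreal (real DIM('a) * unit_ball_vol DIM('a) / p * \<kappa>)) (at_right 0)"
proof -
  define c where "c = real DIM('a) * unit_ball_vol DIM('a) / p"
  have c: "0 < c" using p by (simp add: c_def)
  have [measurable]: "w \<sigma> \<in> borel_measurable borel" for \<sigma> unfolding w_def by measurable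
  define I where "I \<sigma> = ennreal \<sigma> * (\<integral>\<^sup>+ h. K h * w \<sigma> h \<partial>lborel)" for \<sigma>
  define A where "A = enn2real (\<integral>\<^sup>+ h. K h * w \<sigma>\<^sub>0 h \<partial>lborel)"
  have A: "(\<integral>\<^sup>+ h. K h * w \<sigma>\<^sub>0 h \<partial>lborel) = ennreal A" "0 \<le> A"
    using fin by (auto simp: A_def)
  have tail: "ennreal \<sigma> * (\<integral>\<^sup>+ h. w \<sigma> h * indicator {h. R \<le> norm h} h \<partial>lborel)
      = ennreal (c * R powr (- p * \<sigma>))" if "0 < R" "0 < \<sigma>" for R \<sigma>
    using that p unfolding w_def
    by (subst nn_integral_norm_powr_outside_ball)
       (auto simp: ennreal_mult[symmetric] c_def field_simps)
  have lower: "ennreal (a * (c * R powr (- p * \<sigma>))) \<le> I \<sigma>"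
    if R: "0 < R" and \<sigma>: "0 < \<sigma>" and a: "\<And>h. R \<le> norm h \<Longrightarrow> ennreal a \<le> K h" for a R \<sigma>
  proof (cases "0 \<le> a")
    case True
    have "ennreal (a * (c * R powr (- p * \<sigma>)))
      = ennreal a * (ennreal \<sigma> * (\<integral>\<^sup>+ h. w \<sigma> h * indicator {h. R \<le> norm h} h \<partial>lborel))"
      unfolding tail[OF R \<sigma>] using True c by (simp add: ennreal_mult)
    also have "\<dots> = ennreal \<sigma> * (\<integral>\<^sup>+ h. ennreal a * (w \<sigma> h * indicator {h. R \<le> norm h} h) \<partial>lborel)"
      by (subst nn_integral_cmult) (auto simp: mult.left_commute)
    also have "\<dots> \<le> I \<sigma>"
      unfolding I_def
      by (intro mult_left_mono nn_integral_mono) (auto simp: indicator_def intro!: mult_right_mono a)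
    finally show ?thesis .
  next
    case False
    then have "a * (c * R powr (- p * \<sigma>)) \<le> 0"
      using c by (intro mult_nonpos_nonneg) auto
    then show ?thesis by (simp add: ennreal_neg)
  qed
  have upper: "I \<sigma> \<le> ennreal (\<sigma> * (R powr (p * (\<sigma>\<^sub>0 - \<sigma>)) * A) + b * (c * R powr (- p * \<sigma>)))"
    if R: "0 < R" and \<sigma>: "0 < \<sigma>" "\<sigma> < \<sigma>\<^sub>0" and b: "\<And>h. R \<le> norm h \<Longrightarrow> K h \<le> ennreal b"
      and b0: "0 \<le> b" for b R \<sigma>
  proof -
    have "I \<sigma> \<le> ennreal \<sigma> * (\<integral>\<^sup>+ h. ennreal (R powr (p * (\<sigma>\<^sub>0 - \<sigma>))) * (K h * w \<sigma>\<^sub>0 h)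
        + ennreal b * (w \<sigma> h * indicator {h. R \<le> norm h} h) \<partial>lborel)"
      unfolding I_def
    proof (intro mult_left_mono nn_integral_mono)
      fix h :: 'a
      show "K h * w \<sigma> h \<le> ennreal (R powr (p * (\<sigma>\<^sub>0 - \<sigma>))) * (K h * w \<sigma>\<^sub>0 h)
        + ennreal b * (w \<sigma> h * indicator {h. R \<le> norm h} h)"
      proof (cases "R \<le> norm h")
        case True
        then have "K h * w \<sigma> h \<le> ennreal b * (w \<sigma> h * indicator {h. R \<le> norm h} h)"
          by (simp add: mult_right_mono b)
        then show ?thesis by (simp add: add_increasing)
      next
        case False
        \<comment> \<open>Inside the ball the surplus factor \<open>|h|\<^bsup>p (\<sigma>\<^sub>0 - \<sigma>)\<^esup>\<close> has a positive exponent, so it is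
          largest on the boundary.\<close>
        have "norm h powr - (real DIM('a) + p * \<sigma>)
          = norm h powr (p * (\<sigma>\<^sub>0 - \<sigma>)) * norm h powr - (real DIM('a) + p * \<sigma>\<^sub>0)"
          by (simp add: powr_add[symmetric] algebra_simps)
        also have "\<dots> \<le> R powr (p * (\<sigma>\<^sub>0 - \<sigma>)) * norm h powr - (real DIM('a) + p * \<sigma>\<^sub>0)"
          using False \<sigma> p by (intro mult_right_mono powr_mono2) auto
        finally have "w \<sigma> h \<le> ennreal (R powr (p * (\<sigma>\<^sub>0 - \<sigma>))) * w \<sigma>\<^sub>0 h"
          unfolding w_def by (simp add: ennreal_mult[symmetric] ennreal_leI)
        then have "K h * w \<sigma> h \<le> K h * (ennreal (R powr (p * (\<sigma>\<^sub>0 - \<sigma>))) * w \<sigma>\<^sub>0 h)"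
          by (intro mult_left_mono) auto
        then show ?thesis using False by (simp add: mult_ac)
      qed
    qed auto
    also have "\<dots> = ennreal \<sigma> * (ennreal (R powr (p * (\<sigma>\<^sub>0 - \<sigma>))) * ennreal A) +
        ennreal b * (ennreal \<sigma> * (\<integral>\<^sup>+ h. w \<sigma> h * indicator {h. R \<le> norm h} h \<partial>lborel))"
    proof -
      have "(\<integral>\<^sup>+ h. ennreal (R powr (p * (\<sigma>\<^sub>0 - \<sigma>))) * (K h * w \<sigma>\<^sub>0 h)
          + ennreal b * (w \<sigma> h * indicator {h. R \<le> norm h} h) \<partial>lborel)
        = ennreal (R powr (p * (\<sigma>\<^sub>0 - \<sigma>))) * ennreal A
          + ennreal b * (\<integral>\<^sup>+ h. w \<sigma> h * indicator {h. R \<le> norm h} h \<partial>lborel)"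
        by (simp add: nn_integral_add nn_integral_cmult A(1))
      then show ?thesis by (simp only: distrib_left mult.left_commute)
    qed
    also have "\<dots> = ennreal (\<sigma> * (R powr (p * (\<sigma>\<^sub>0 - \<sigma>)) * A) + b * (c * R powr (- p * \<sigma>)))"
      using \<sigma> A b0 c unfolding tail[OF R \<sigma>(1)]
      by (simp add: ennreal_mult[symmetric] ennreal_plus[symmetric] del: ennreal_plus)
    finally show ?thesis .
  qed
  have pos: "\<forall>\<^sub>F \<sigma> in at_right 0. 0 < \<sigma> \<and> \<sigma> < \<sigma>\<^sub>0"
    using \<sigma>\<^sub>0 eventually_at_right_real by (auto simp: greaterThanLessThan_iff)
  have "(I \<longlongrightarrow> ennreal (c * \<kappa>)) (at_right 0)"
  proof (rule order_tendstoI)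
    fix y assume y: "y < ennreal (c * \<kappa>)"
    then obtain y' where y': "y = ennreal y'" "0 \<le> y'" by (cases y) auto
    then have less: "y' < c * \<kappa>" using y by (simp add: ennreal_less_iff)
    \<comment> \<open>A value strictly between \<open>y' / c\<close> and \<open>\<kappa>\<close> leaves room on both sides.\<close>
    define a where "a = (y' / c + \<kappa>) / 2"
    have a: "y' < c * a" "a < \<kappa>" using less c by (auto simp: a_def field_simps)
    then have a0: "0 < a" using y' c by (smt (verit) zero_less_mult_pos)
    have "\<forall>\<^sub>F h in at_infinity. ennreal a < K h"
      using lim a a0 by (intro order_tendstoD) (auto simp: ennreal_less_iff)
    then obtain R where R: "0 < R" "\<And>h. R \<le> norm h \<Longrightarrow> ennreal a \<le> K h"
      unfolding eventually_at_infinity_pos by (auto intro: less_imp_le)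
    have "((\<lambda>\<sigma>. a * (c * R powr (- p * \<sigma>))) \<longlongrightarrow> a * (c * R powr (- p * 0))) (at_right 0)"
      using R by (intro tendsto_intros) auto
    then have "\<forall>\<^sub>F \<sigma> in at_right 0. y' < a * (c * R powr (- p * \<sigma>))"
      using a R by (intro order_tendstoD) (auto simp: mult.commute)
    with pos show "\<forall>\<^sub>F \<sigma> in at_right 0. y < I \<sigma>"
    proof eventually_elim
      case (elim \<sigma>)
      then have "y < ennreal (a * (c * R powr (- p * \<sigma>)))"
        using y' by (simp add: ennreal_less_iff)
      also have "\<dots> \<le> I \<sigma>" using elim R by (intro lower) auto
      finally show ?case .
    qed
  next
    fix y assume y: "ennreal (c * \<kappa>) < y"
    obtain z where z: "ennreal (c * \<kappa>) < z" "z < y" using dense[OF y] by blast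
    then obtain y' where "z = ennreal y'" by (cases z) auto
    with z have y': "ennreal (c * \<kappa>) < ennreal y'" "ennreal y' < y" by auto
    have less: "c * \<kappa> < y'" using y' c \<kappa> by (simp add: ennreal_less_iff)
    define b where "b = (y' / c + \<kappa>) / 2"
    have b: "c * b < y'" "\<kappa> < b" using less c by (auto simp: b_def field_simps)
    have "\<forall>\<^sub>F h in at_infinity. K h < ennreal b"
      using lim b \<kappa> by (intro order_tendstoD) (auto simp: ennreal_less_iff)
    then obtain R where R: "0 < R" "\<And>h. R \<le> norm h \<Longrightarrow> K h \<le> ennreal b"
      unfolding eventually_at_infinity_pos by (auto intro: less_imp_le)
    have "((\<lambda>\<sigma>. \<sigma> * (R powr (p * (\<sigma>\<^sub>0 - \<sigma>)) * A) + b * (c * R powr (- p * \<sigma>)))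
      \<longlongrightarrow> 0 * (R powr (p * (\<sigma>\<^sub>0 - 0)) * A) + b * (c * R powr (- p * 0))) (at_right 0)"
      using R by (intro tendsto_intros) auto
    then have "\<forall>\<^sub>F \<sigma> in at_right 0. \<sigma> * (R powr (p * (\<sigma>\<^sub>0 - \<sigma>)) * A) + b * (c * R powr (- p * \<sigma>)) < y'"
      using b R by (intro order_tendstoD) (auto simp: mult.commute)
    with pos show "\<forall>\<^sub>F \<sigma> in at_right 0. I \<sigma> < y"
    proof eventually_elim
      case (elim \<sigma>)
      have "I \<sigma> \<le> ennreal (\<sigma> * (R powr (p * (\<sigma>\<^sub>0 - \<sigma>)) * A) + b * (c * R powr (- p * \<sigma>)))"
        using elim R b \<kappa> by (intro upper) auto
      also have "\<dots> \<le> ennreal y'" using elim by (intro ennreal_leI) auto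
      finally show ?case using y'(2) by (rule le_less_trans)
    qed
  qed
  then show ?thesis unfolding I_def[abs_def] c_def .
qed

section \<open>The Gagliardo integral of a single function\<close>

lemma nn_integral_gagliardo_shift:
  fixes f :: "'a::euclidean_space \<Rightarrow> real"
  assumes [measurable]: "f \<in> borel_measurable borel"
  shows "(\<integral>\<^sup>+ z. ennreal (\<bar>f (fst z) - f (snd z)\<bar> powr p / norm (fst z - snd z) powr s)
        \<partial>(lborel :: ('a \<times> 'a) measure))
    = (\<integral>\<^sup>+ h. (\<integral>\<^sup>+ x. ennreal (\<bar>f x - f (h + x)\<bar> powr p) \<partial>lborel) * ennreal (norm h powr - s) \<partial>lborel)"
proof -
  let ?F = "\<lambda>z :: 'a \<times> 'a. ennreal (\<bar>f (fst z) - f (snd z)\<bar> powr p / norm (fst z - snd z) powr s)"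
  let ?k = "\<lambda>x h. ennreal (\<bar>f x - f (h + x)\<bar> powr p) * ennreal (norm h powr - s)"
  have "(\<integral>\<^sup>+ z. ?F z \<partial>lborel) = (\<integral>\<^sup>+ z. ?F z \<partial>(lborel \<Otimes>\<^sub>M lborel))"
    by (simp add: lborel_prod)
  also have "\<dots> = (\<integral>\<^sup>+ x. \<integral>\<^sup>+ y. ?F (x, y) \<partial>lborel \<partial>lborel)"
    by (subst lborel.nn_integral_fst) auto
  also have "\<dots> = (\<integral>\<^sup>+ x. \<integral>\<^sup>+ h. ?k x h \<partial>lborel \<partial>lborel)"
  proof (rule nn_integral_cong)
    fix x :: 'a
    have "(\<integral>\<^sup>+ y. ?F (x, y) \<partial>lborel) = (\<integral>\<^sup>+ h. ?F (x, h + x) \<partial>lborel)"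
      by (rule nn_integral_shift) measurable
    also have "\<dots> = (\<integral>\<^sup>+ h. ?k x h \<partial>lborel)"
      by (intro nn_integral_cong) (simp add: ennreal_mult[symmetric] powr_minus_divide)
    finally show "(\<integral>\<^sup>+ y. ?F (x, y) \<partial>lborel) = (\<integral>\<^sup>+ h. ?k x h \<partial>lborel)" .
  qed
  also have "\<dots> = (\<integral>\<^sup>+ h. \<integral>\<^sup>+ x. ?k x h \<partial>lborel \<partial>lborel)"
    by (rule lborel_pair.Fubini'[symmetric]) (simp add: case_prod_beta, measurable)
  also have "\<dots> = (\<integral>\<^sup>+ h. (\<integral>\<^sup>+ x. ennreal (\<bar>f x - f (h + x)\<bar> powr p) \<partial>lborel) * ennreal (norm h powr - s) \<partial>lborel)"
    by (intro nn_integral_cong nn_integral_multc) measurable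
  finally show ?thesis .
qed

text \<open>
  The set where \<open>P\<close> holds need not be Borel, so the product measure is applied to the complement
  of a Borel null set that contains all exceptions.
\<close>

lemma AE_lborel_prod_fst_snd:
  assumes "AE x in (lborel :: 'a::euclidean_space measure). P x"
  shows "AE z in (lborel :: ('a \<times> 'a) measure). P (fst z) \<and> P (snd z)"
proof -
  from assms obtain N where N: "{x. \<not> P x} \<subseteq> N" "N \<in> null_sets lborel"
    by (auto simp: eventually_ae_filter)
  then have [measurable]: "N \<in> sets borel" and out: "AE x in lborel. x \<notin> N"
    by (auto simp: null_sets_def intro: AE_not_in)
  have "AE z in lborel \<Otimes>\<^sub>M lborel. fst z \<notin> N \<and> snd z \<notin> N"
  proof (rule lborel_pair.AE_pair_measure)
    show "AE x in lborel. AE y in lborel. fst (x, y) \<notin> N \<and> snd (x, y) \<notin> N"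
      using out by eventually_elim (use out in simp)
  qed measurable
  then show ?thesis
    unfolding lborel_prod by eventually_elim (use N in auto)
qed

text \<open>
  The case \<open>l = 0\<close>, due to Maz'ya and Shaposhnikova.  A Borel representative of \<open>g\<close> gives access to
  Tonelli's theorem, which needs the product of the Borel \<open>\<sigma>\<close>-algebras rather than its completion.
\<close>

lemma tendsto_gagliardo_integral:
  fixes g :: "'a::euclidean_space \<Rightarrow> real" and p \<sigma>\<^sub>0 :: real
  defines "G \<equiv> \<lambda>\<sigma>. \<integral>\<^sup>+ z. ennreal (\<bar>g (fst z) - g (snd z)\<bar> powr p
      / norm (fst z - snd z) powr (real DIM('a) + p * \<sigma>)) \<partial>(lebesgue :: ('a \<times> 'a) measure)"
  assumes p: "1 \<le> p" and \<sigma>\<^sub>0: "0 < \<sigma>\<^sub>0"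
    and g: "g \<in> borel_measurable lebesgue"
    and int: "integrable lebesgue (\<lambda>x. \<bar>g x\<bar> powr p)"
    and fin: "G \<sigma>\<^sub>0 < \<infinity>"
  shows "((\<lambda>\<sigma>. ennreal \<sigma> * G \<sigma>) \<longlongrightarrow>
    ennreal (4 * pi powr (real DIM('a) / 2) / (p * Gamma (real DIM('a) / 2))
      * (LINT x|lebesgue. \<bar>g x\<bar> powr p))) (at_right 0)"
proof -
  obtain f where f [measurable]: "f \<in> borel_measurable borel" and gf: "AE x in lborel. g x = f x"
    using completion_ex_borel_measurable_real[OF g] by auto
  have AE_eq: "AE x in lebesgue. \<bar>g x\<bar> powr p = \<bar>f x\<bar> powr p"
    unfolding AE_completion_iff using gf by eventually_elim simp
  have f_leb [measurable]: "f \<in> borel_measurable lebesgue"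
    by (rule measurable_completion) simp
  note [measurable] = g
  have powr_meas: "(\<lambda>x. \<bar>g x\<bar> powr p) \<in> borel_measurable lebesgue"
      "(\<lambda>x. \<bar>f x\<bar> powr p) \<in> borel_measurable lebesgue"
    by measurable
  have "integrable lebesgue (\<lambda>x. \<bar>f x\<bar> powr p)"
    using int by (subst integrable_cong_AE[symmetric, OF powr_meas AE_eq])
  then have int_f: "integrable lborel (\<lambda>x. \<bar>f x\<bar> powr p)"
    by (subst (asm) integrable_completion) auto
  have "(LINT x|lebesgue. \<bar>g x\<bar> powr p) = (LINT x|lebesgue. \<bar>f x\<bar> powr p)"
    by (intro integral_cong_AE AE_eq powr_meas)
  also have "\<dots> = (LINT x|lborel. \<bar>f x\<bar> powr p)"
    by (rule integral_completion) measurable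
  finally have norm_eq: "(LINT x|lebesgue. \<bar>g x\<bar> powr p) = (LINT x|lborel. \<bar>f x\<bar> powr p)" .
  define K where "K h = (\<integral>\<^sup>+ x. ennreal (\<bar>f x - f (h + x)\<bar> powr p) \<partial>lborel)" for h
  have K [measurable]: "K \<in> borel_measurable borel" unfolding K_def by measurable
  have G: "G \<sigma> = (\<integral>\<^sup>+ h. K h * ennreal (norm h powr - (real DIM('a) + p * \<sigma>)) \<partial>lborel)" for \<sigma>
  proof -
    have "G \<sigma> = (\<integral>\<^sup>+ z. ennreal (\<bar>f (fst z) - f (snd z)\<bar> powr p
        / norm (fst z - snd z) powr (real DIM('a) + p * \<sigma>)) \<partial>(lborel :: ('a \<times> 'a) measure))"
      unfolding G_def nn_integral_completion
    proof (rule nn_integral_cong_AE)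
      show "AE z in lborel. ennreal (\<bar>g (fst z) - g (snd z)\<bar> powr p
            / norm (fst z - snd z) powr (real DIM('a) + p * \<sigma>))
          = ennreal (\<bar>f (fst z) - f (snd z)\<bar> powr p
            / norm (fst z - snd z) powr (real DIM('a) + p * \<sigma>))"
        using AE_lborel_prod_fst_snd[OF gf] by eventually_elim simp
    qed
    also have "\<dots> = (\<integral>\<^sup>+ h. K h * ennreal (norm h powr - (real DIM('a) + p * \<sigma>)) \<partial>lborel)"
      unfolding K_def by (rule nn_integral_gagliardo_shift) measurable
    finally show ?thesis .
  qed
  have "((\<lambda>\<sigma>. ennreal \<sigma> * G \<sigma>) \<longlongrightarrow> ennreal (real DIM('a) * unit_ball_vol DIM('a) / p
      * (2 * (LINT x|lborel. \<bar>f x\<bar> powr p)))) (at_right 0)"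
    unfolding G
  proof (rule tendsto_scaled_singular_integral[OF _ \<sigma>\<^sub>0 _ K])
    show "(K \<longlongrightarrow> ennreal (2 * (LINT x|lborel. \<bar>f x\<bar> powr p))) at_infinity"
      unfolding K_def using p f int_f by (rule tendsto_shift_difference_powr_at_infinity)
    show "(\<integral>\<^sup>+ h. K h * ennreal (norm h powr - (real DIM('a) + p * \<sigma>\<^sub>0)) \<partial>lborel) < \<infinity>"
      using fin unfolding G .
  qed (use p in auto)
  also have "real DIM('a) * unit_ball_vol DIM('a) / p * (2 * (LINT x|lborel. \<bar>f x\<bar> powr p))
    = 4 * pi powr (real DIM('a) / 2) / (p * Gamma (real DIM('a) / 2)) * (LINT x|lebesgue. \<bar>g x\<bar> powr p)"
    unfolding norm_eq using dim_times_unit_ball_vol[of "real DIM('a)"] by (simp add: mult_ac)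
  finally show ?thesis .
qed

section \<open>Summation over the derivatives of order \<open>l\<close>\<close>

theorem theorem3p4:
  fixes v :: "real ^ 'n::finite \<Rightarrow> real" and p \<sigma>\<^sub>0 :: real and l :: nat
  assumes "1 \<le> p" and "0 < \<sigma>\<^sub>0" and "\<sigma>\<^sub>0 < 1"
    and "v \<in> frac_sobolev l \<sigma>\<^sub>0 p"
  shows "((\<lambda>\<sigma>. ennreal \<sigma> * gagliardo_pow l \<sigma> p v) \<longlongrightarrow>
           ennreal (4 * pi powr (real CARD('n) / 2) / (p * Gamma (real CARD('n) / 2))
                      * sobolev_seminorm l p v powr p)) (at_right 0)"
proof -
  define M where "M = {\<alpha> :: nat ^ 'n. mi_order \<alpha> = l}"
  have M: "finite M" unfolding M_def by (rule finite_mi_order)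
  define c where "c = 4 * pi powr (real CARD('n) / 2) / (p * Gamma (real CARD('n) / 2))"
  have c: "0 \<le> c" using assms(1) Gamma_real_pos[of "real CARD('n) / 2"] by (simp add: c_def)
  define G where "G \<alpha> \<sigma> = (\<integral>\<^sup>+ z. ennreal (\<bar>weak_deriv \<alpha> v (fst z) - weak_deriv \<alpha> v (snd z)\<bar> powr p
      / norm (fst z - snd z) powr (real CARD('n) + p * \<sigma>))
      \<partial>(lebesgue :: ((real ^ 'n) \<times> (real ^ 'n)) measure))" for \<alpha> \<sigma>
  define N where "N \<alpha> = (LINT x|lebesgue. \<bar>weak_deriv \<alpha> v x\<bar> powr p)" for \<alpha>
  have N: "0 \<le> N \<alpha>" for \<alpha> unfolding N_def by (intro integral_nonneg_AE) auto
  have Lp: "weak_deriv \<alpha> v \<in> Lp p" if "\<alpha> \<in> M" for \<alpha>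
    using assms(4) that by (auto simp: frac_sobolev_def sobolev_def M_def)
  have "(\<Sum>\<alpha>\<in>M. G \<alpha> \<sigma>\<^sub>0) < \<infinity>"
    using assms(4) by (simp add: frac_sobolev_def gagliardo_pow_def G_def M_def)
  then have fin: "G \<alpha> \<sigma>\<^sub>0 < \<infinity>" if "\<alpha> \<in> M" for \<alpha>
    using that M by (auto simp: less_top[symmetric] ennreal_sum_eq_top)
  have "((\<lambda>\<sigma>. ennreal \<sigma> * G \<alpha> \<sigma>) \<longlongrightarrow> ennreal (c * N \<alpha>)) (at_right 0)" if "\<alpha> \<in> M" for \<alpha>
    using tendsto_gagliardo_integral[of p \<sigma>\<^sub>0 "weak_deriv \<alpha> v"] assms(1,2) Lp[OF that] fin[OF that]
    by (simp add: Lp_def G_def N_def c_def)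
  then have "((\<lambda>\<sigma>. \<Sum>\<alpha>\<in>M. ennreal \<sigma> * G \<alpha> \<sigma>) \<longlongrightarrow> (\<Sum>\<alpha>\<in>M. ennreal (c * N \<alpha>))) (at_right 0)"
    by (intro tendsto_sum)
  also have "(\<Sum>\<alpha>\<in>M. ennreal (c * N \<alpha>)) = ennreal (c * (\<Sum>\<alpha>\<in>M. N \<alpha>))"
    using c N by (simp add: sum_distrib_left)
  also have "(\<Sum>\<alpha>\<in>M. N \<alpha>) = sobolev_seminorm l p v powr p"
    using assms(1) N by (simp add: sobolev_seminorm_def N_def M_def powr_powr sum_nonneg)
  finally show ?thesis
    by (simp add: gagliardo_pow_def G_def M_def c_def sum_distrib_left)
qed

end
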